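(* Let $\nabla_S u=\mathcal{O}(\varepsilon)$, $\hat\gamma=\mathcal{O}(\varepsilon)$ and $\nabla_S\hat\gamma=\mathcal{O}(\varepsilon)$. Then there holds (on an edge $E=T_L\cap T_R$ shared by two elements) $$\sphericalangle(\nu_L,\nu_R)\circ\phi-\sphericalangle(\hat\nu_L,\hat\nu_R)=[\![((\nabla_S u)^\top\hat\nu)_{\hat\mu}]\!]+\mathcal{O}(\varepsilon^2).$$
   Context: $\mathscr{T}$ is a triangulation, by possibly curved triangles and/or quadrilaterals $T\subset\mathbb{R}^3$, approximating an oriented surface $S\subset\mathbb{R}^3$ (the mid-surface of a shell in its initial configuration); it is continuous but not necessarily $C^1$. On each $T$, $\hat\nu$ is the unit normal (orientation inherited from the surface) and $P=I-\hat\nu\otimes\hat\nu$. For scalar $f$ on $T$, the surface gradient is $\nabla_S f=P\nabla\tilde F$, where $\tilde F$ is an extension of $f$ to a neighbourhood in $\mathbb{R}^3$ (the result does not depend on the extension); for vector-valued functions $\nabla_S$ is applied row-wise (the $i$-th row is $(\nabla_S u_i)^\top$). On the boundary of each element $T$, $\hat\tau$ is the unit edge tangent oriented such that the co-normal $\hat\mu=\hat\nu\times\hat\tau$ points out of $T$. Subscripts $L,R$ denote values taken from the two elements $T_L,T_R$ sharing the edge $E$. For a vector field $v$, $v_{\hat\mu}=v\cdot\hat\mu$ and $[\![v_{\hat\mu}]\!]=v_L\cdot\hat\mu_L+v_R\cdot\hat\mu_R$ on $E$; hence $[\![((\nabla_S u)^\top\hat\nu)_{\hat\mu}]\!]=\hat\nu_L\cdot(\nabla_S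 u)_L\hat\mu_L+\hat\nu_R\cdot(\nabla_S u)_R\hat\mu_R$. The displacement $u$ is a continuous, element-wise smooth $\mathbb{R}^3$-valued function on $\mathscr{T}$, and the shear $\hat\gamma$ is an element-wise smooth tangential vector field ($\hat\gamma\cdot\hat\nu=0$) whose edge-tangential component is continuous across elements. $\varepsilon$ is a small parameter and $\mathcal{O}$ is the Landau symbol. $\phi=\mathrm{id}+u$ is the deformation and $F=\nabla_S\phi=P+\nabla_S u$ (of rank two). The deformed normal, computed element-wise, is $\nu\circ\phi=\frac{\mathrm{cof}(F)\hat\nu}{\|\mathrm{cof}(F)\hat\nu\|}$ with $\mathrm{cof}$ the cofactor matrix. The angle between two vectors $a,b\in\mathbb{R}^3$ is $\sphericalangle(a,b)=\arccos\big(\frac{a\cdot b}{\|a\|\,\|b\|}\big)$, and $\sphericalangle(\nu_L,\nu_R)\circ\phi=\sphericalangle(\nu_L\circ\phi,\nu_R\circ\phi)$.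
   Formalization: The fold at the edge points considered is assumed convex or flat, both initially and, for small ε, after deformation; with the unsigned arccos angle the formula fails otherwise (coplanar triangles, u = ε|x|e_z: the angle change is 2 arctan ε, the jump is −2ε). *)

theory Defs
  imports "HOL-Analysis.Analysis" "HOL-Library.Landau_Symbols"
begin

section \<open>Smooth functions\<close>

primrec Ck_on ::
    "nat \<Rightarrow> 'a::real_normed_vector set \<Rightarrow> ('a \<Rightarrow> 'b::real_normed_vector) \<Rightarrow> bool" where
  "Ck_on 0 U f \<longleftrightarrow> continuous_on U f"
| "Ck_on (Suc k) U f \<longleftrightarrow> (\<forall>x\<in>U. f differentiable (at x)) \<and>
     (\<forall>v. Ck_on k U (\<lambda>x. frechet_derivative f (at x) v))"

definition smooth_on ::
    "'a::real_normed_vector set \<Rightarrow> ('a \<Rightarrow> 'b::real_normed_vector) \<Rightarrow> bool" where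
  "smooth_on U f \<longleftrightarrow> (\<forall>k. Ck_on k U f)"

text \<open>\<open>g\<close> extends \<open>f\<close> from the (closed) set \<open>A\<close> to a smooth function on a neighbourhood of \<open>A\<close>.\<close>

definition smooth_extension ::
    "'a::real_normed_vector set \<Rightarrow> ('a \<Rightarrow> 'b::real_normed_vector) \<Rightarrow> ('a \<Rightarrow> 'b) \<Rightarrow> bool" where
  "smooth_extension A f g \<longleftrightarrow>
     (\<exists>U. open U \<and> A \<subseteq> U \<and> smooth_on U g) \<and> (\<forall>x\<in>A. g x = f x)"

section \<open>Curved triangles and quadrilaterals\<close>

datatype elem_shape = Triangle | Quadrilateral

text \<open>A curved element is the image of a reference triangle or square under a chart. Only the
  values of the chart on a neighbourhood of the reference cell matter. The chart also fixes the
  orientation of the element.\<close>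

record element =
  shape :: elem_shape
  chart :: "real^2 \<Rightarrow> real^3"

fun ref_vertices :: "elem_shape \<Rightarrow> (real^2) list" where
  "ref_vertices Triangle = [0, axis 1 1, axis 2 1]"
| "ref_vertices Quadrilateral = [0, axis 1 1, axis 1 1 + axis 2 1, axis 2 1]"

definition nedges :: "element \<Rightarrow> nat" where
  "nedges T = length (ref_vertices (shape T))"

definition ref_cell :: "element \<Rightarrow> (real^2) set" where
  "ref_cell T = convex hull (set (ref_vertices (shape T)))"

definition ref_vertex :: "element \<Rightarrow> nat \<Rightarrow> real^2" where
  "ref_vertex T i = ref_vertices (shape T) ! (i mod nedges T)"

definition elem_set :: "element \<Rightarrow> (real^3) set" where
  "elem_set T = chart T ` ref_cell T"

definition vertices :: "element \<Rightarrow> (real^3) set" where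
  "vertices T = chart T ` set (ref_vertices (shape T))"

definition edge :: "element \<Rightarrow> nat \<Rightarrow> (real^3) set" where
  "edge T i = chart T ` closed_segment (ref_vertex T i) (ref_vertex T (Suc i))"

definition ref_point :: "element \<Rightarrow> real^3 \<Rightarrow> real^2" where
  "ref_point T x = inv_into (ref_cell T) (chart T) x"

definition chart_deriv :: "element \<Rightarrow> real^3 \<Rightarrow> real^2 \<Rightarrow> real^3" where
  "chart_deriv T x = frechet_derivative (chart T) (at (ref_point T x))"

definition regular_element :: "element \<Rightarrow> bool" where
  "regular_element T \<longleftrightarrow>
     (\<exists>U. open U \<and> ref_cell T \<subseteq> U \<and> smooth_on U (chart T)) \<and>
     inj_on (chart T) (ref_cell T) \<and>
     (\<forall>x\<in>elem_set T. inj (chart_deriv T x))"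

text \<open>The initial unit normal.\<close>

definition normal :: "element \<Rightarrow> real^3 \<Rightarrow> real^3" where
  "normal T x =
     (let n = cross3 (chart_deriv T x (axis 1 1)) (chart_deriv T x (axis 2 1))
      in (1 / norm n) *\<^sub>R n)"

definition outer :: "real^3 \<Rightarrow> real^3 \<Rightarrow> real^3^3" where
  "outer a b = (\<chi> i j. a $ i * b $ j)"

definition tangent_proj :: "element \<Rightarrow> real^3 \<Rightarrow> real^3^3" where
  "tangent_proj T x = mat 1 - outer (normal T x) (normal T x)"

text \<open>Since the reference cells are convex, \<open>chart_deriv T x (q - ref_point T x)\<close> with \<open>q\<close> in the
  reference cell ranges over the directions pointing from \<open>x\<close> into \<open>T\<close>. The sign condition
  is meaningful at the end points of an edge, too.\<close>

definition points_out :: "element \<Rightarrow> real^3 \<Rightarrow> real^3 \<Rightarrow> bool" where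
  "points_out T x m \<longleftrightarrow>
     (\<forall>q\<in>ref_cell T. m \<bullet> chart_deriv T x (q - ref_point T x) \<le> 0)"

text \<open>The unit tangent of the \<open>i\<close>-th edge, with the sign for which \<open>normal \<times> tangent\<close> points out
  of the element.\<close>

definition tangent :: "element \<Rightarrow> nat \<Rightarrow> real^3 \<Rightarrow> real^3" where
  "tangent T i x =
     (let d = chart_deriv T x (ref_vertex T (Suc i) - ref_vertex T i);
          t = (1 / norm d) *\<^sub>R d
      in if points_out T x (cross3 (normal T x) t) then t else - t)"

definition conormal :: "element \<Rightarrow> nat \<Rightarrow> real^3 \<Rightarrow> real^3" where
  "conormal T i x = cross3 (normal T x) (tangent T i x)"

section \<open>Triangulations\<close>

definition conforming :: "element set \<Rightarrow> bool" where
  "conforming M \<longleftrightarrow> (\<forall>T\<in>M. \<forall>T'\<in>M. T \<noteq> T' \<longrightarrow>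
     elem_set T \<inter> elem_set T' = {} \<or>
     (\<exists>v\<in>vertices T \<inter> vertices T'. elem_set T \<inter> elem_set T' = {v}) \<or>
     (\<exists>i<nedges T. \<exists>j<nedges T'.
        elem_set T \<inter> elem_set T' = edge T i \<and> edge T i = edge T' j))"

text \<open>\<open>T\<close> and \<open>T'\<close> are different elements whose common edge is the \<open>i\<close>-th edge of \<open>T\<close> and the
  \<open>j\<close>-th edge of \<open>T'\<close>.\<close>

definition share_edge :: "element \<Rightarrow> nat \<Rightarrow> element \<Rightarrow> nat \<Rightarrow> bool" where
  "share_edge T i T' j \<longleftrightarrow> T \<noteq> T' \<and> i < nedges T \<and> j < nedges T' \<and>
     elem_set T \<inter> elem_set T' = edge T i \<and> edge T i = edge T' j"

text \<open>The normals of the elements come from one orientation of the surface: neighbours induce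
  opposite orientations on their common edge.\<close>

definition consistently_oriented :: "element set \<Rightarrow> bool" where
  "consistently_oriented M \<longleftrightarrow> (\<forall>T\<in>M. \<forall>T'\<in>M. \<forall>i j. share_edge T i T' j \<longrightarrow>
     (\<forall>x\<in>edge T i. tangent T i x = - tangent T' j x))"

definition shell_mesh :: "element set \<Rightarrow> bool" where
  "shell_mesh M \<longleftrightarrow> finite M \<and> (\<forall>T\<in>M. regular_element T) \<and>
     conforming M \<and> consistently_oriented M"

definition mesh_set :: "element set \<Rightarrow> (real^3) set" where
  "mesh_set M = (\<Union>T\<in>M. elem_set T)"

section \<open>Surface gradients\<close>

definition gradient :: "(real^3 \<Rightarrow> real) \<Rightarrow> real^3 \<Rightarrow> real^3" where
  "gradient g x = (\<chi> k. frechet_derivative g (at x) (axis k 1))"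

text \<open>On a regular element the value does not depend on the chosen extension.\<close>

definition surf_grad :: "element \<Rightarrow> (real^3 \<Rightarrow> real) \<Rightarrow> real^3 \<Rightarrow> real^3" where
  "surf_grad T f x = tangent_proj T x *v gradient (SOME g. smooth_extension (elem_set T) f g) x"

definition surf_jac :: "element \<Rightarrow> (real^3 \<Rightarrow> real^3) \<Rightarrow> real^3 \<Rightarrow> real^3^3" where
  "surf_jac T u x = (\<chi> i. surf_grad T (\<lambda>y. u y $ i) x)"

definition smooth_on_elem :: "element \<Rightarrow> (real^3 \<Rightarrow> real^3) \<Rightarrow> bool" where
  "smooth_on_elem T u \<longleftrightarrow> (\<exists>g. smooth_extension (elem_set T) u g)"

section \<open>Displacement and shear\<close>

definition displacement :: "element set \<Rightarrow> (real^3 \<Rightarrow> real^3) \<Rightarrow> bool" where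
  "displacement M u \<longleftrightarrow> continuous_on (mesh_set M) u \<and> (\<forall>T\<in>M. smooth_on_elem T u)"

text \<open>The shear is in general multi-valued on edges, hence a family indexed by the elements.\<close>

definition shear :: "element set \<Rightarrow> (element \<Rightarrow> real^3 \<Rightarrow> real^3) \<Rightarrow> bool" where
  "shear M \<gamma> \<longleftrightarrow>
     (\<forall>T\<in>M. smooth_on_elem T (\<gamma> T) \<and> (\<forall>x\<in>elem_set T. \<gamma> T x \<bullet> normal T x = 0)) \<and>
     (\<forall>T\<in>M. \<forall>T'\<in>M. \<forall>i j. share_edge T i T' j \<longrightarrow>
        (\<forall>x\<in>edge T i. \<gamma> T x \<bullet> tangent T i x = \<gamma> T' x \<bullet> tangent T i x))"

section \<open>Deformed configuration\<close>

definition deformation :: "(real^3 \<Rightarrow> real^3) \<Rightarrow> real^3 \<Rightarrow> real^3" where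
  "deformation u x = x + u x"

definition def_grad :: "element \<Rightarrow> (real^3 \<Rightarrow> real^3) \<Rightarrow> real^3 \<Rightarrow> real^3^3" where
  "def_grad T u = surf_jac T (deformation u)"

text \<open>The \<open>(i,j)\<close> cofactor (signed minor): replacing row \<open>i\<close> by the \<open>j\<close>-th unit vector and
  clearing the rest of column \<open>j\<close>.\<close>

definition cof :: "real^'n^'n \<Rightarrow> real^'n^'n" where
  "cof A = (\<chi> i j. det (\<chi> k l. if k = i \<and> l = j then 1
                                 else if k = i \<or> l = j then 0 else A $ k $ l))"

text \<open>\<open>\<nu> \<circ> \<phi>\<close>, as a function on the initial element.\<close>

definition def_normal :: "element \<Rightarrow> (real^3 \<Rightarrow> real^3) \<Rightarrow> real^3 \<Rightarrow> real^3" where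
  "def_normal T u x =
     (let n = cof (def_grad T u x) *v normal T x in (1 / norm n) *\<^sub>R n)"

text \<open>The conormal \<open>\<nu> \<times> \<tau>\<close> of the deformed element, pulled back by the deformation; the
  deformed tangent \<open>\<tau>\<close> is the normalised image of the initial one.\<close>

definition def_conormal :: "element \<Rightarrow> nat \<Rightarrow> (real^3 \<Rightarrow> real^3) \<Rightarrow> real^3 \<Rightarrow> real^3" where
  "def_conormal T i u x =
     (let t = def_grad T u x *v tangent T i x
      in cross3 (def_normal T u x) ((1 / norm t) *\<^sub>R t))"

definition vec_angle :: "'a::real_inner \<Rightarrow> 'a \<Rightarrow> real" where
  "vec_angle a b = arccos ((a \<bullet> b) / (norm a * norm b))"

text \<open>A fold with outward conormals \<open>mL\<close>, \<open>mR\<close> and normals \<open>nL\<close>, \<open>nR\<close> along a common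
  edge is convex or flat if, to first order, each element lies weakly below the tangent plane of the other one.
  As \<open>nL\<close> and \<open>nR\<close> are orthogonal to the edge, and the orientations are consistent, both
  inner products are then equal to the sine of the angle from \<open>nL\<close> to \<open>nR\<close>, counted
  positively for a convex fold. So this is the condition for the unsigned angle
  \<open>vec_angle nL nR\<close> to be the signed bending angle.\<close>

definition convex_fold :: "real^3 \<Rightarrow> real^3 \<Rightarrow> real^3 \<Rightarrow> real^3 \<Rightarrow> bool" where
  "convex_fold nL mL nR mR \<longleftrightarrow> 0 \<le> nL \<bullet> mR \<and> 0 \<le> nR \<bullet> mL"

text \<open>The jump across an edge of the conormal component of a vector field with values \<open>vL\<close>,
  \<open>vR\<close> on the two sides.\<close>

definition conormal_jump ::
    "element \<Rightarrow> nat \<Rightarrow> element \<Rightarrow> nat \<Rightarrow> (real^3 \<Rightarrow> real^3) \<Rightarrow> (real^3 \<Rightarrow> real^3) \<Rightarrow> real^3 \<Rightarrow> real" where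
  "conormal_jump TL i TR j vL vR x = vL x \<bullet> conormal TL i x + vR x \<bullet> conormal TR j x"

definition rotation_field :: "element \<Rightarrow> (real^3 \<Rightarrow> real^3) \<Rightarrow> real^3 \<Rightarrow> real^3" where
  "rotation_field T u x = transpose (surf_jac T u x) *v normal T x"

text \<open>\<open>f \<epsilon> x = O(\<epsilon>^k)\<close> for \<open>\<epsilon> \<longrightarrow> 0+\<close>, uniformly in \<open>x \<in> A\<close>.\<close>

definition uniform_bigo ::
    "(real^3) set \<Rightarrow> nat \<Rightarrow> (real \<Rightarrow> real^3 \<Rightarrow> 'b::real_normed_vector) \<Rightarrow> bool" where
  "uniform_bigo A k f \<longleftrightarrow>
     (\<lambda>(\<epsilon>, x). norm (f \<epsilon> x)) \<in> O[at_right 0 \<times>\<^sub>F principal A](\<lambda>(\<epsilon>, x). \<epsilon> ^ k)"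

end

theory Submission
  imports Defs
begin

text \<open>
  Why the formula holds. Fix a point of the edge, with unit tangent \<open>t\<close> of the left element, normals
  \<open>n\<close> and outward conormals \<open>m\<close>, one pair per element. By the consistent orientation the right
  element has the tangent \<open>-t\<close>. Write \<open>H\<close> for the surface Jacobian of the displacement. The deformed
  normal of an element is the normalised cross product of the images \<open>t + H t\<close> and \<open>m + H m\<close>, and to
  first order it is \<open>n - (n \<bullet> H t) t - (n \<bullet> H m) m\<close> (\<open>deformed_normal_expansion\<close>). Since the
  displacement is single-valued on the edge, \<open>H t\<close> is the same vector on both sides
  (\<open>tangential_derivative_continuous_across_edge\<close>), hence both deformed normals are orthogonal to
  one common deformed tangent, and the angle between them is an angle in the plane orthogonal to it.
  Only the rotations of the two normals about the edge, by \<open>k = n \<bullet> H m\<close> on each side, change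
  this angle to first order, so that it changes by \<open>kL + kR\<close>. This sum is the conormal jump.

  The unsigned angle is an arccosine, whose derivative blows up where the normals are parallel,
  so a direct expansion is not uniform. Instead, the convexity of the fold, before and after
  the deformation, identifies the sine of the angle with a triple product of the two normals and the edge tangent
  (\<open>sin_angle_about_axis\<close>). Then cosine and sine both have expansions with a quadratic remainder
  that does not depend on the angle, and the
  addition theorems turn these into an expansion of the sine of the difference \<open>\<beta> - \<alpha>\<close> of the two
  angles, while its cosine stays positive (\<open>angle_difference_from_sin_cos\<close>). All constants are
  explicit, which makes the estimate at a single point (\<open>bending_angle_expansion\<close>) uniform along the edge.

  The surface Jacobian is defined by an arbitrarily chosen smooth extension. It acts on tangent
  vectors as the derivative of any smooth extension (\<open>surf_jac_mult_tangential\<close>): the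
  difference of two extensions vanishes on the element, and since a reference cell is convex and has
  sides in two independent directions, its one-sided derivatives determine the derivative on the whole
  tangent plane, even at edges and vertices. The same argument with the segment of the reference
  edge in place of the cell gives the continuity of \<open>H t\<close>.
\<close>

section \<open>Orthonormal frames and first-order expansions\<close>

lemma norm_matrix_vector_mult_le:
  fixes A :: "real^'n^'m"
  shows "norm (A *v x) \<le> norm A * norm x"
proof -
  have "norm (A *v x) = L2_set (\<lambda>i. norm (A $ i \<bullet> x)) UNIV"
    by (simp add: norm_vec_def matrix_vector_mul_component)
  also have "\<dots> \<le> L2_set (\<lambda>i. norm (A $ i) * norm x) UNIV"
    by (rule L2_set_mono) (simp_all add: Cauchy_Schwarz_ineq2)
  also have "\<dots> = norm A * norm x"
    by (simp add: norm_vec_def[of A] L2_set_left_distrib)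
  finally show ?thesis .
qed

lemma cof_mult_cross:
  fixes A :: "real^3^3"
  shows "cof A *v cross3 a b = cross3 (A *v a) (A *v b)"
  by (simp add: cof_def vec_eq_iff forall_3 det_3 matrix_vector_mult_def sum_3 cross3_def
      vector_def algebra_simps)

lemma cross3_cross3_right: "cross3 a (cross3 b c) = (a \<bullet> c) *\<^sub>R b - (a \<bullet> b) *\<^sub>R c"
  by (simp add: cross3_simps forall_3)

lemma inner_cross3_cross3:
  "cross3 a b \<bullet> cross3 c d = (a \<bullet> c) * (b \<bullet> d) - (a \<bullet> d) * (b \<bullet> c)"
  by (simp add: cross3_simps forall_3)

lemma inner_cross3_cyclic: "a \<bullet> cross3 b c = b \<bullet> cross3 c a"
  by (simp add: cross3_simps)

lemma norm_cross3_le: "norm (cross3 a b) \<le> norm a * norm b"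
proof -
  have "(norm (cross3 a b))\<^sup>2 \<le> (norm a * norm b)\<^sup>2"
    using norm_cross_dot[of a b] zero_le_power2[of "a \<bullet> b"] by linarith
  then show ?thesis by (simp add: power2_le_iff_abs_le)
qed

lemma norm_cross3_orthonormal:
  assumes "norm a = 1" "norm b = 1" "a \<bullet> b = 0"
  shows "norm (cross3 a b) = 1"
  using norm_cross_dot[of a b] assms by (simp add: power2_eq_imp_eq)

lemma frame_expansion:
  assumes "norm n = 1" "norm t = 1" "n \<bullet> t = 0"
  shows "x = (x \<bullet> n) *\<^sub>R n + (x \<bullet> t) *\<^sub>R t + (x \<bullet> cross3 n t) *\<^sub>R cross3 n t"
proof -
  let ?m = "cross3 n t"
  define y where "y = x - ((x \<bullet> n) *\<^sub>R n + (x \<bullet> t) *\<^sub>R t + (x \<bullet> ?m) *\<^sub>R ?m)"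
  have m: "norm ?m = 1" using norm_cross3_orthonormal assms by blast
  have 1: "n \<bullet> n = 1" "t \<bullet> t = 1" "?m \<bullet> ?m = 1" "t \<bullet> n = 0"
    using assms m by (simp_all add: dot_square_norm inner_commute)
  have "y \<bullet> n = 0" "y \<bullet> t = 0" "y \<bullet> ?m = 0"
    using 1 assms by (simp_all add: y_def algebra_simps dot_cross_self)
  then have "norm y = 0"
    using norm_cross_dot[of y ?m] m by (simp add: cross3_cross3_right)
  then show ?thesis by (simp add: y_def)
qed

text \<open>Normalising moves \<open>x\<close> by the defect of its length from \<open>1 = norm a\<close>, which is at most its distance
  from \<open>a\<close>.\<close>

lemma norm_diff_normalized_le:
  fixes x a :: "'a::real_inner"
  assumes "norm a = 1" "x \<noteq> 0"
  shows "norm ((1 / norm x) *\<^sub>R x - a) \<le> 2 * norm (x - a)"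
proof -
  have "norm ((1 / norm x) *\<^sub>R x - x) = norm ((1 / norm x - 1) *\<^sub>R x)"
    by (simp add: algebra_simps)
  also have "\<dots> = \<bar>norm a - norm x\<bar>"
    using assms by (simp add: left_diff_distrib flip: abs_mult) (simp add: field_simps)
  also have "\<dots> \<le> norm (x - a)" by (metis norm_minus_commute norm_triangle_ineq3)
  finally have "norm ((1 / norm x) *\<^sub>R x - x) \<le> norm (x - a)" .
  then show ?thesis using norm_triangle_ineq[of "(1 / norm x) *\<^sub>R x - x" "x - a"] by simp
qed

text \<open>The sphere is curved only to second order: a small change of a unit vector has a quadratic
  component along that vector.\<close>

lemma inner_diff_unit:
  fixes x a :: "'a::real_inner"
  assumes "norm x = 1" "norm a = 1"
  shows "(x - a) \<bullet> a = - (norm (x - a))\<^sup>2 / 2"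
proof -
  have "(norm (x - a))\<^sup>2 = x \<bullet> x - 2 * (x \<bullet> a) + a \<bullet> a"
    by (simp add: power2_norm_eq_inner algebra_simps inner_commute)
  then show ?thesis using assms by (simp add: dot_square_norm algebra_simps)
qed

text \<open>The first-order part of the deformed normal is read off from its defining properties, without expanding
  the normalised cross product: orthogonality to \<open>t + a\<close> and \<open>m + b\<close> gives the components of
  \<open>\<nu> - n\<close> along \<open>t\<close> and \<open>m\<close>, and the unit length makes the one along \<open>n\<close> quadratic. The cross product
  serves only to show that \<open>\<nu>\<close> is close to \<open>n\<close>, and not to \<open>-n\<close>.\<close>

lemma deformed_normal_expansion:
  fixes n t a b :: "real^3" and h :: real
  assumes nt: "norm n = 1" "norm t = 1" "n \<bullet> t = 0"
    and m: "m = cross3 n t"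
    and ab: "norm a \<le> h" "norm b \<le> h" and h: "h \<le> 1/100"
    and \<nu>: "\<nu> = (1 / norm (cross3 (t + a) (m + b))) *\<^sub>R cross3 (t + a) (m + b)"
  shows "norm \<nu> = 1" "\<nu> \<bullet> (t + a) = 0" "norm (\<nu> - n) \<le> 6 * h"
    "norm (\<nu> - n + (a \<bullet> n) *\<^sub>R t + (b \<bullet> n) *\<^sub>R m) \<le> 30 * h\<^sup>2"
proof -
  define N where "N = cross3 (t + a) (m + b)"
  have h0: "0 \<le> h" using ab norm_ge_zero order_trans by blast
  have m1: "norm m = 1" using norm_cross3_orthonormal nt m by blast
  have tm: "cross3 t m = n"
    using nt by (simp add: m cross3_cross3_right dot_square_norm inner_commute)
  have "N - n = cross3 t b + cross3 a m + cross3 a b"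
    by (simp add: N_def cross_add_left cross_add_right tm)
  then have "norm (N - n) \<le> norm (cross3 t b) + norm (cross3 a m) + norm (cross3 a b)"
    by (metis norm_triangle_le norm_triangle_ineq add_right_mono)
  also have "\<dots> \<le> norm b + norm a + norm a * norm b"
    using norm_cross3_le[of t b] norm_cross3_le[of a m] norm_cross3_le[of a b] nt m1 by simp
  also have "norm a * norm b \<le> h * 1" using ab h h0 by (intro mult_mono) auto
  finally have Nn: "norm (N - n) \<le> 3 * h" using ab by simp
  have N0: "N \<noteq> 0" using Nn nt h by auto
  have \<nu>N: "\<nu> = (1 / norm N) *\<^sub>R N" by (simp add: \<nu> N_def)
  show \<nu>1: "norm \<nu> = 1" using N0 by (simp add: \<nu>N)
  show \<nu>t: "\<nu> \<bullet> (t + a) = 0" by (simp add: \<nu> dot_cross_self)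
  have \<nu>m: "\<nu> \<bullet> (m + b) = 0" by (simp add: \<nu> dot_cross_self)
  show d: "norm (\<nu> - n) \<le> 6 * h"
    using norm_diff_normalized_le[OF nt(1) N0] Nn by (simp add: \<nu>N)
  define r where "r = \<nu> - n + (a \<bullet> n) *\<^sub>R t + (b \<bullet> n) *\<^sub>R m"
  have sq: "n \<bullet> n = 1" "t \<bullet> t = 1" "m \<bullet> m = 1" using nt m1 by (simp_all add: dot_square_norm)
  have ort: "n \<bullet> t = 0" "t \<bullet> n = 0" "m \<bullet> n = 0" "n \<bullet> m = 0" "m \<bullet> t = 0" "t \<bullet> m = 0"
    using nt by (simp_all add: m dot_cross_self inner_commute)
  have "r \<bullet> n = (\<nu> - n) \<bullet> n" by (simp add: r_def inner_add_left ort)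
  then have rn: "r \<bullet> n = - (norm (\<nu> - n))\<^sup>2 / 2" using inner_diff_unit[OF \<nu>1 nt(1)] by simp
  have rt: "r \<bullet> t = - (a \<bullet> (\<nu> - n))"
    using \<nu>t by (simp add: r_def sq ort algebra_simps inner_commute)
  have rm: "r \<bullet> m = - (b \<bullet> (\<nu> - n))"
    using \<nu>m by (simp add: r_def sq ort algebra_simps inner_commute)
  have "norm r \<le> \<bar>r \<bullet> n\<bar> + \<bar>r \<bullet> t\<bar> + \<bar>r \<bullet> m\<bar>"
  proof -
    have "norm r = norm ((r \<bullet> n) *\<^sub>R n + (r \<bullet> t) *\<^sub>R t + (r \<bullet> m) *\<^sub>R m)"
      using frame_expansion[OF nt, of r] m by simp
    also have "\<dots> \<le> norm ((r \<bullet> n) *\<^sub>R n) + norm ((r \<bullet> t) *\<^sub>R t) + norm ((r \<bullet> m) *\<^sub>R m)"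
      by (metis norm_triangle_le norm_triangle_ineq add_right_mono)
    finally show ?thesis using nt m1 by simp
  qed
  also have "\<bar>r \<bullet> n\<bar> \<le> 18 * h\<^sup>2"
    using power_mono[OF d, of 2] by (simp add: rn power_mult_distrib)
  also have "\<bar>r \<bullet> t\<bar> \<le> h * (6 * h)"
    unfolding rt abs_minus
    by (rule order_trans[OF Cauchy_Schwarz_ineq2]) (intro mult_mono ab d h0 norm_ge_zero)
  also have "\<bar>r \<bullet> m\<bar> \<le> h * (6 * h)"
    unfolding rm abs_minus
    by (rule order_trans[OF Cauchy_Schwarz_ineq2]) (intro mult_mono ab d h0 norm_ge_zero)
  finally show "norm (\<nu> - n + (a \<bullet> n) *\<^sub>R t + (b \<bullet> n) *\<^sub>R m) \<le> 30 * h\<^sup>2"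
    by (simp add: r_def power2_eq_square)
qed

lemma first_order_inner:
  fixes nL nR dL dR wL wR :: "'a::real_inner"
  assumes "norm nL = 1" "norm nR = 1"
    and "norm dL \<le> D" "norm dR \<le> D" "norm (dL - wL) \<le> E" "norm (dR - wR) \<le> E"
  shows "\<bar>(nL + dL) \<bullet> (nR + dR) - nL \<bullet> nR - (wL \<bullet> nR + wR \<bullet> nL)\<bar> \<le> 2 * E + D\<^sup>2"
proof -
  have D0: "0 \<le> D" using assms(3) norm_ge_zero order_trans by blast
  have "(nL + dL) \<bullet> (nR + dR) - nL \<bullet> nR - (wL \<bullet> nR + wR \<bullet> nL)
      = (dL - wL) \<bullet> nR + (dR - wR) \<bullet> nL + dL \<bullet> dR"
    by (simp add: algebra_simps inner_commute)
  moreover have "\<bar>(dL - wL) \<bullet> nR\<bar> \<le> E" "\<bar>(dR - wR) \<bullet> nL\<bar> \<le> E"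
    using assms Cauchy_Schwarz_ineq2[of "dL - wL" nR] Cauchy_Schwarz_ineq2[of "dR - wR" nL] by simp_all
  moreover have "\<bar>dL \<bullet> dR\<bar> \<le> D * D"
    by (rule order_trans[OF Cauchy_Schwarz_ineq2]) (intro mult_mono assms D0 norm_ge_zero)
  ultimately show ?thesis by (simp add: power2_eq_square)
qed

lemma abs_triple_product_le: "\<bar>a \<bullet> cross3 b c\<bar> \<le> norm a * (norm b * norm c)"
  by (rule order_trans[OF Cauchy_Schwarz_ineq2]) (intro mult_left_mono norm_cross3_le norm_ge_zero)

text \<open>A small change \<open>\<sigma>\<close> of the unit axis has no first-order effect on the triple product: the cross product
  of the normals is parallel to \<open>t\<close>, and the component of \<open>\<sigma>\<close> along \<open>t\<close> is quadratic. So only the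
  first-order parts \<open>wL\<close>, \<open>wR\<close> of the changes of the normals appear, and the change of the axis needs to be
  known only up to its size.\<close>

lemma first_order_triple_product:
  fixes nL nR dL dR wL wR t \<sigma> :: "real^3"
  assumes n: "norm nL = 1" "norm nR = 1" "norm t = 1" "norm (t + \<sigma>) = 1"
      "nL \<bullet> t = 0" "nR \<bullet> t = 0"
    and d: "norm dL \<le> D" "norm dR \<le> D" "norm \<sigma> \<le> D"
    and w: "norm (dL - wL) \<le> E" "norm (dR - wR) \<le> E" and D: "D \<le> 1"
  shows "\<bar>(nR + dR) \<bullet> cross3 (nL + dL) (t + \<sigma>) - nR \<bullet> cross3 nL t
      - (wR \<bullet> cross3 nL t + wL \<bullet> cross3 nR (- t))\<bar> \<le> 2 * E + 5 * D\<^sup>2"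
proof -
  have D0: "0 \<le> D" using d(1) norm_ge_zero order_trans by blast
  have "nR \<bullet> cross3 nL \<sigma> = (\<sigma> \<bullet> t) * (t \<bullet> cross3 nR nL)"
  proof -
    have "nR \<bullet> cross3 nL \<sigma> = \<sigma> \<bullet> cross3 nR nL" by (simp add: cross3_simps)
    \<comment> \<open>both normals are orthogonal to the axis\<close>
    moreover have "cross3 nR nL = (t \<bullet> cross3 nR nL) *\<^sub>R t"
    proof -
      have "cross3 nR nL \<bullet> cross3 nL t = 0" "cross3 nR nL \<bullet> nL = 0"
        using n by (simp_all add: inner_cross3_cross3 dot_cross_self)
      then show ?thesis
        using frame_expansion[OF n(1,3,5), of "cross3 nR nL"] by (simp add: inner_commute)
    qed
    ultimately show ?thesis by (metis inner_scaleR_right mult.commute)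
  qed
  moreover have "\<bar>\<sigma> \<bullet> t\<bar> \<le> D\<^sup>2 / 2"
    using inner_diff_unit[of "t + \<sigma>" t] n d(3) power_mono[of "norm \<sigma>" D 2] by simp
  moreover have "\<bar>t \<bullet> cross3 nR nL\<bar> \<le> 1" using abs_triple_product_le[of t nR nL] n by simp
  ultimately have 1: "\<bar>nR \<bullet> cross3 nL \<sigma>\<bar> \<le> D\<^sup>2 / 2 * 1"
    using mult_mono[of "\<bar>\<sigma> \<bullet> t\<bar>" "D\<^sup>2 / 2" "\<bar>t \<bullet> cross3 nR nL\<bar>" 1] by (simp add: abs_mult)
  have 2: "\<bar>dR \<bullet> cross3 dL t\<bar> \<le> D * (D * 1)"
    by (rule order_trans[OF abs_triple_product_le])
      (use n in \<open>intro mult_mono d D0 norm_ge_zero mult_nonneg_nonneg, simp_all\<close>)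
  have 3: "\<bar>dR \<bullet> cross3 nL \<sigma>\<bar> \<le> D * (1 * D)"
    by (rule order_trans[OF abs_triple_product_le])
      (use n in \<open>intro mult_mono d D0 norm_ge_zero mult_nonneg_nonneg, simp_all\<close>)
  have 4: "\<bar>nR \<bullet> cross3 dL \<sigma>\<bar> \<le> 1 * (D * D)"
    by (rule order_trans[OF abs_triple_product_le])
      (use n D0 in \<open>intro mult_mono d norm_ge_zero mult_nonneg_nonneg, simp_all\<close>)
  have 5: "\<bar>dR \<bullet> cross3 dL \<sigma>\<bar> \<le> 1 * (D * D)"
    by (rule order_trans[OF abs_triple_product_le])
      (use D D0 order_trans[OF d(2) D] in \<open>intro mult_mono d norm_ge_zero mult_nonneg_nonneg, simp_all\<close>)
  have 6: "\<bar>(dR - wR) \<bullet> cross3 nL t\<bar> \<le> E"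
    using abs_triple_product_le[of "dR - wR" nL t] n w by simp
  have 7: "\<bar>(dL - wL) \<bullet> cross3 nR (- t)\<bar> \<le> E"
    using abs_triple_product_le[of "dL - wL" nR "- t"] n w by simp
  have "(nR + dR) \<bullet> cross3 (nL + dL) (t + \<sigma>) - nR \<bullet> cross3 nL t
      - (wR \<bullet> cross3 nL t + wL \<bullet> cross3 nR (- t))
    = nR \<bullet> cross3 nL \<sigma> + dR \<bullet> cross3 dL t + dR \<bullet> cross3 nL \<sigma> + nR \<bullet> cross3 dL \<sigma>
      + dR \<bullet> cross3 dL \<sigma> + (dR - wR) \<bullet> cross3 nL t + (dL - wL) \<bullet> cross3 nR (- t)"
    using inner_cross3_cyclic[of nR dL t] cross_skew[of t nR]
    by (simp add: cross_add_left cross_add_right inner_add_left inner_add_right inner_diff_left)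
  then show ?thesis using 1 2 3 4 5 6 7 by (simp add: power2_eq_square)
qed

section \<open>Angles between unit normals\<close>

text \<open>Expanding \<open>b\<close> in the orthonormal frame \<open>a\<close>, \<open>s\<close>, \<open>cross3 a s\<close> shows that its two coordinates in
  the plane orthogonal to \<open>s\<close> lie on the unit circle. The sign condition selects the half circle that the
  arccosine parametrises.\<close>

lemma sin_angle_about_axis:
  fixes a b s :: "real^3"
  assumes "norm a = 1" "norm b = 1" "norm s = 1" "a \<bullet> s = 0" "b \<bullet> s = 0"
    and "0 \<le> b \<bullet> cross3 a s"
  shows "cos (vec_angle a b) = a \<bullet> b" "sin (vec_angle a b) = b \<bullet> cross3 a s"
    "0 \<le> vec_angle a b" "vec_angle a b \<le> pi"
proof -
  have "b \<bullet> b = b \<bullet> ((b \<bullet> a) *\<^sub>R a + (b \<bullet> s) *\<^sub>R s + (b \<bullet> cross3 a s) *\<^sub>R cross3 a s)"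
    using frame_expansion[OF assms(1,3,4), of b] by simp
  then have 1: "1 = (a \<bullet> b)\<^sup>2 + (b \<bullet> cross3 a s)\<^sup>2"
    using assms by (simp add: inner_add_right dot_square_norm power2_eq_square inner_commute)
  have c: "\<bar>a \<bullet> b\<bar> \<le> 1" using Cauchy_Schwarz_ineq2[of a b] assms by simp
  show "cos (vec_angle a b) = a \<bullet> b"
    using c assms by (simp add: vec_angle_def cos_arccos_abs)
  show "sin (vec_angle a b) = b \<bullet> cross3 a s"
    using c assms 1 by (simp add: vec_angle_def sin_arccos_abs) (metis add_diff_cancel_left' real_sqrt_unique)
  show "0 \<le> vec_angle a b" "vec_angle a b \<le> pi"
    using c assms by (auto simp add: vec_angle_def abs_le_iff intro!: arccos_lbound arccos_ubound)
qed

text \<open>Positivity of the cosine confines \<open>x\<close> to the interval where the sine is bounded below by a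
  multiple of its argument.\<close>

lemma angle_le_mult_sin:
  fixes x :: real
  assumes "\<bar>x\<bar> \<le> pi" "0 < cos x"
  shows "\<bar>x\<bar> \<le> 5 * \<bar>sin x\<bar>" "\<bar>sin x - x\<bar> \<le> x\<^sup>2 / 2"
proof -
  show 1: "\<bar>sin x - x\<bar> \<le> x\<^sup>2 / 2"
    using Maclaurin_sin_bound[of x 2] by (simp add: numeral_2_eq_2 sin_coeff_def)
  have "\<bar>x\<bar> < pi / 2"
  proof (rule ccontr)
    assume "\<not> ?thesis"
    then have "cos \<bar>x\<bar> \<le> cos (pi / 2)"
      using assms(1) by (intro cos_monotone_0_pi_le) auto
    then show False using assms(2) by simp
  qed
  then have "\<bar>x\<bar> \<le> 8/5" using pi_less_4 pi_approx by simp
  then have "\<bar>x\<bar> * \<bar>x\<bar> \<le> 8/5 * \<bar>x\<bar>" by (rule mult_right_mono) simp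
  then have "x\<^sup>2 / 2 \<le> 4/5 * \<bar>x\<bar>" by (simp add: power2_eq_square)
  then show "\<bar>x\<bar> \<le> 5 * \<bar>sin x\<bar>" using 1 by linarith
qed

text \<open>The hypotheses say that \<open>(cos \<beta>, sin \<beta>)\<close> is \<open>(cos \<alpha>, sin \<alpha>)\<close> plus \<open>k\<close> times the unit tangent of the
  circle there, up to an error \<open>e\<close>. Rotating by \<open>-\<alpha>\<close> through the addition theorems reduces the claim to
  \<open>\<alpha> = 0\<close>. Since the arccosine is never differentiated, angles near \<open>0\<close> and \<open>pi\<close> need no special treatment.\<close>

lemma angle_difference_from_sin_cos:
  fixes \<alpha> \<beta> k e :: real
  assumes "0 \<le> \<alpha>" "\<alpha> \<le> pi" "0 \<le> \<beta>" "\<beta> \<le> pi"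
    and c: "\<bar>cos \<beta> - cos \<alpha> + k * sin \<alpha>\<bar> \<le> e"
    and s: "\<bar>sin \<beta> - sin \<alpha> - k * cos \<alpha>\<bar> \<le> e"
    and e: "2 * e < 1"
  shows "\<bar>\<beta> - \<alpha> - k\<bar> \<le> 2 * e + 25 / 2 * (\<bar>k\<bar> + 2 * e)\<^sup>2"
proof -
  define E1 where "E1 = cos \<beta> - cos \<alpha> + k * sin \<alpha>"
  define E2 where "E2 = sin \<beta> - sin \<alpha> - k * cos \<alpha>"
  have 1: "sin \<alpha> * sin \<alpha> + cos \<alpha> * cos \<alpha> = 1"
    using sin_cos_squared_add3[of \<alpha>] by linarith
  have eqs: "cos \<beta> = cos \<alpha> - k * sin \<alpha> + E1" "sin \<beta> = sin \<alpha> + k * cos \<alpha> + E2"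
    by (simp_all add: E1_def E2_def)
  have small: "\<bar>x * sin \<alpha>\<bar> \<le> e" "\<bar>x * cos \<alpha>\<bar> \<le> e" if "\<bar>x\<bar> \<le> e" for x
    using that mult_mono[of "\<bar>x\<bar>" e "\<bar>sin \<alpha>\<bar>" 1] mult_mono[of "\<bar>x\<bar>" e "\<bar>cos \<alpha>\<bar>" 1]
    by (auto simp: abs_mult)
  have b: "\<bar>E1 * sin \<alpha>\<bar> \<le> e" "\<bar>E1 * cos \<alpha>\<bar> \<le> e" "\<bar>E2 * sin \<alpha>\<bar> \<le> e" "\<bar>E2 * cos \<alpha>\<bar> \<le> e"
    using small[of E1] small[of E2] c s by (simp_all add: E1_def E2_def)
  have "sin (\<beta> - \<alpha>) = k * (sin \<alpha> * sin \<alpha> + cos \<alpha> * cos \<alpha>) + E2 * cos \<alpha> - E1 * sin \<alpha>"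
    unfolding sin_diff eqs by algebra
  then have S: "\<bar>sin (\<beta> - \<alpha>) - k\<bar> \<le> 2 * e" using b unfolding 1 by simp
  have "cos (\<beta> - \<alpha>) = (sin \<alpha> * sin \<alpha> + cos \<alpha> * cos \<alpha>) + E1 * cos \<alpha> + E2 * sin \<alpha>"
    unfolding cos_diff eqs by algebra
  then have C: "0 < cos (\<beta> - \<alpha>)" using b e unfolding 1 by linarith
  have "\<bar>\<beta> - \<alpha>\<bar> \<le> pi" using assms by linarith
  note a = angle_le_mult_sin[OF this C]
  have "\<bar>sin (\<beta> - \<alpha>)\<bar> \<le> \<bar>k\<bar> + 2 * e" using S by linarith
  then have "\<bar>\<beta> - \<alpha>\<bar> \<le> 5 * (\<bar>k\<bar> + 2 * e)"
    by (intro order_trans[OF a(1)]) simp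
  then have "(\<beta> - \<alpha>)\<^sup>2 \<le> (5 * (\<bar>k\<bar> + 2 * e))\<^sup>2"
    by (metis abs_ge_zero power2_abs power_mono)
  then have "(\<beta> - \<alpha>)\<^sup>2 / 2 \<le> 25 / 2 * (\<bar>k\<bar> + 2 * e)\<^sup>2"
    by (simp only: power_mult_distrib) simp
  then show ?thesis using a(2) S by linarith
qed

text \<open>The edge formula at a single point, as a statement about vectors: \<open>a\<close> is the change of the common edge
  tangent, \<open>bL\<close> and \<open>bR\<close> are the changes of the conormals. Rotations of the normals towards \<open>t\<close> are invisible
  in the plane orthogonal to \<open>t\<close>; rotations towards the conormals add up. The bound on \<open>h\<close>
  keeps the deformed vectors away from zero and the remainders below the threshold of
  \<open>angle_difference_from_sin_cos\<close>. The constant is crude; what matters is that it does not depend on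
  the angle.\<close>

lemma bending_angle_expansion:
  fixes nL nR t a bL bR mL mR \<nu>L \<nu>R p :: "real^3" and h :: real
  defines "mL \<equiv> cross3 nL t" and "mR \<equiv> cross3 nR (- t)" and "p \<equiv> t + a"
  defines "\<nu>L \<equiv> (1 / norm (cross3 p (mL + bL))) *\<^sub>R cross3 p (mL + bL)"
    and "\<nu>R \<equiv> (1 / norm (cross3 (- p) (mR + bR))) *\<^sub>R cross3 (- p) (mR + bR)"
  assumes nt: "norm nL = 1" "norm nR = 1" "norm t = 1" "nL \<bullet> t = 0" "nR \<bullet> t = 0"
    and h: "norm a \<le> h" "norm bL \<le> h" "norm bR \<le> h" "h \<le> 1/100"
    and fold: "0 \<le> nR \<bullet> mL" "0 \<le> \<nu>R \<bullet> cross3 \<nu>L ((1 / norm p) *\<^sub>R p)"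
  shows "\<bar>vec_angle \<nu>L \<nu>R - vec_angle nL nR - (bL \<bullet> nL + bR \<bullet> nR)\<bar> \<le> 2000 * h\<^sup>2"
proof -
  define s where "s = (1 / norm p) *\<^sub>R p"
  define kL where "kL = bL \<bullet> nL" define kR where "kR = bR \<bullet> nR"
  define wL where "wL = - ((a \<bullet> nL) *\<^sub>R t) - kL *\<^sub>R mL"
  define wR where "wR = - ((a \<bullet> nR) *\<^sub>R t) - kR *\<^sub>R mR"
  have h0: "0 \<le> h" using h(1) norm_ge_zero order_trans by blast
  have hh: "h\<^sup>2 \<le> 1/100 * h" using mult_right_mono[OF h(4) h0] by (simp add: power2_eq_square)
  have L: "norm \<nu>L = 1" "\<nu>L \<bullet> p = 0" "norm (\<nu>L - nL) \<le> 6 * h" "norm (\<nu>L - nL - wL) \<le> 30 * h\<^sup>2"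
    using deformed_normal_expansion[where n = nL and t = t and a = a and b = bL and h = h and \<nu> = \<nu>L and m = mL]
      nt h by (simp_all add: mL_def \<nu>L_def p_def wL_def kL_def algebra_simps)
  have R: "norm \<nu>R = 1" "\<nu>R \<bullet> p = 0" "norm (\<nu>R - nR) \<le> 6 * h" "norm (\<nu>R - nR - wR) \<le> 30 * h\<^sup>2"
    using deformed_normal_expansion[where n = nR and t = "- t" and a = "- a" and b = bR and h = h and \<nu> = \<nu>R and m = mR]
      nt h by (simp_all add: mR_def \<nu>R_def p_def wR_def kR_def algebra_simps)
  have "p \<noteq> 0" using nt(3) h by (auto simp: p_def add_eq_0_iff)
  then have s1: "norm s = 1" and ss: "norm (s - t) \<le> 2 * h"
    using norm_diff_normalized_le[of t p] nt(3) h(1) by (auto simp: s_def p_def)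
  have s0: "\<nu>L \<bullet> s = 0" "\<nu>R \<bullet> s = 0" using L(2) R(2) by (simp_all add: s_def)
  note \<beta> = sin_angle_about_axis[OF L(1) R(1) s1 s0 fold(2)[folded s_def]]
  note \<alpha> = sin_angle_about_axis[OF nt fold(1)[unfolded mL_def]]
  have mm: "mR \<bullet> mL = - (nL \<bullet> nR)" "mR \<bullet> nL = nR \<bullet> mL"
    and tm: "t \<bullet> mL = 0" "t \<bullet> mR = 0" "t \<bullet> nL = 0" "t \<bullet> nR = 0"
    using nt by (simp_all add: mL_def mR_def inner_cross3_cross3 dot_square_norm inner_commute dot_cross_self)
      (simp add: cross3_simps)
  \<comment> \<open>the derivative of the cosine of the angle: minus its sine times the sum of the rotations\<close>
  have c: "\<bar>\<nu>L \<bullet> \<nu>R - nL \<bullet> nR + (kL + kR) * (nR \<bullet> mL)\<bar> \<le> 300 * h\<^sup>2"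
  proof -
    have "wL \<bullet> nR + wR \<bullet> nL = - (kL + kR) * (nR \<bullet> mL)"
      using mm tm by (simp add: wL_def wR_def algebra_simps inner_commute)
    then show ?thesis
      using first_order_inner[OF nt(1,2) L(3) R(3) L(4) R(4)] by (simp add: power_mult_distrib algebra_simps)
  qed
  \<comment> \<open>the derivative of the sine of the angle: its cosine times the sum of the rotations\<close>
  have s: "\<bar>\<nu>R \<bullet> cross3 \<nu>L s - nR \<bullet> mL - (kL + kR) * (nL \<bullet> nR)\<bar> \<le> 300 * h\<^sup>2"
  proof -
    have "wR \<bullet> mL + wL \<bullet> mR = (kL + kR) * (nL \<bullet> nR)"
      using mm tm by (simp add: wL_def wR_def algebra_simps inner_commute)
    moreover have "\<bar>\<nu>R \<bullet> cross3 \<nu>L s - nR \<bullet> mL - (wR \<bullet> mL + wL \<bullet> mR)\<bar> \<le> 300 * h\<^sup>2"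
      unfolding mL_def mR_def
      using first_order_triple_product[of nL nR t "s - t" "\<nu>L - nL" "6 * h" "\<nu>R - nR" wL "30 * h\<^sup>2" wR]
        nt L R s1 ss h h0 by (simp add: power_mult_distrib)
    ultimately show ?thesis by simp
  qed
  have "\<bar>kL\<bar> \<le> h" "\<bar>kR\<bar> \<le> h"
    using Cauchy_Schwarz_ineq2[of bL nL] Cauchy_Schwarz_ineq2[of bR nR] nt h by (simp_all add: kL_def kR_def)
  then have k: "\<bar>kL + kR\<bar> + 2 * (300 * h\<^sup>2) \<le> 8 * h" using hh by linarith
  have "\<bar>vec_angle \<nu>L \<nu>R - vec_angle nL nR - (kL + kR)\<bar>
      \<le> 2 * (300 * h\<^sup>2) + 25 / 2 * (\<bar>kL + kR\<bar> + 2 * (300 * h\<^sup>2))\<^sup>2"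
    by (rule angle_difference_from_sin_cos)
      (use \<alpha> \<beta> c s hh h(4) in \<open>simp_all add: mL_def\<close>)
  also have "(\<bar>kL + kR\<bar> + 2 * (300 * h\<^sup>2))\<^sup>2 \<le> (8 * h)\<^sup>2"
    by (rule power_mono[OF k]) simp
  finally show ?thesis by (simp add: kL_def kR_def power_mult_distrib)
qed

section \<open>Smooth extensions\<close>

text \<open>The Frechet derivative is a choice among all derivatives, and \<open>f\<close> and \<open>g\<close> have the same ones; so the
  equation holds even where there is none. This is what lets higher smoothness be transported by induction.\<close>

lemma frechet_derivative_cong_open:
  assumes "open U" "x \<in> U" "\<And>y. y \<in> U \<Longrightarrow> f y = g y"
  shows "f differentiable (at x) \<longleftrightarrow> g differentiable (at x)"
    "frechet_derivative f (at x) = frechet_derivative g (at x)"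
proof -
  have "(f has_derivative f') (at x) \<longleftrightarrow> (g has_derivative f') (at x)" for f'
    using has_derivative_transform_within_open[OF _ assms(1,2), of f f' UNIV g]
      has_derivative_transform_within_open[OF _ assms(1,2), of g f' UNIV f] assms(3) by auto
  then show "f differentiable (at x) \<longleftrightarrow> g differentiable (at x)"
    "frechet_derivative f (at x) = frechet_derivative g (at x)"
    by (simp_all add: differentiable_def frechet_derivative_def)
qed

lemma Ck_on_cong:
  assumes "open U" "\<And>x. x \<in> U \<Longrightarrow> f x = g x" "Ck_on k U f"
  shows "Ck_on k U g"
  using assms(2,3)
proof (induction k arbitrary: f g)
  case 0
  then show ?case using continuous_on_cong[of U U f g] by simp
next
  case (Suc k)
  note 1 = frechet_derivative_cong_open[OF assms(1) _ Suc.prems(1)]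
  have "Ck_on k U (\<lambda>x. frechet_derivative g (at x) v)" for v
    using Suc.IH[of "\<lambda>x. frechet_derivative f (at x) v" "\<lambda>x. frechet_derivative g (at x) v"]
      1(2) Suc.prems(2) by simp
  then show ?case using 1(1) Suc.prems(2) by simp
qed

lemma Ck_on_const: "Ck_on k U (\<lambda>x. c)"
  by (induction k arbitrary: c) simp_all

lemma Ck_on_bounded_linear:
  assumes "bounded_linear L"
  shows "Ck_on k U L"
proof (cases k)
  case 0
  then show ?thesis using assms by (simp add: linear_continuous_on)
next
  case (Suc k)
  have "frechet_derivative L (at x) = L" for x
    by (rule frechet_derivative_at[symmetric]) (rule bounded_linear_imp_has_derivative[OF assms])
  then show ?thesis
    using assms by (simp add: Suc bounded_linear_imp_differentiable Ck_on_const)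
qed

lemma
  assumes "f differentiable (at x)" "g differentiable (at x)"
  shows frechet_derivative_plus_at: "frechet_derivative (\<lambda>y. f y + g y) (at x) v
      = frechet_derivative f (at x) v + frechet_derivative g (at x) v"
    and frechet_derivative_diff_at: "frechet_derivative (\<lambda>y. f y - g y) (at x) v
      = frechet_derivative f (at x) v - frechet_derivative g (at x) v"
proof -
  note f = frechet_derivative_works[THEN iffD1, OF assms(1)]
  note g = frechet_derivative_works[THEN iffD1, OF assms(2)]
  show "frechet_derivative (\<lambda>y. f y + g y) (at x) v
      = frechet_derivative f (at x) v + frechet_derivative g (at x) v"
    by (simp flip: frechet_derivative_at[OF has_derivative_add[OF f g]])
  show "frechet_derivative (\<lambda>y. f y - g y) (at x) v
      = frechet_derivative f (at x) v - frechet_derivative g (at x) v"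
    by (simp flip: frechet_derivative_at[OF has_derivative_diff[OF f g]])
qed

lemma Ck_on_add:
  assumes "open U" "Ck_on k U f" "Ck_on k U g"
  shows "Ck_on k U (\<lambda>x. f x + g x)"
  using assms(2,3)
proof (induction k arbitrary: f g)
  case 0
  then show ?case by (simp add: continuous_on_add)
next
  case (Suc k)
  have add: "frechet_derivative (\<lambda>x. f x + g x) (at x) v
      = frechet_derivative f (at x) v + frechet_derivative g (at x) v" if "x \<in> U" for x v
    using Suc.prems that frechet_derivative_plus_at[of f x g] by simp
  have "Ck_on k U (\<lambda>x. frechet_derivative (\<lambda>x. f x + g x) (at x) v)" for v
    by (rule Ck_on_cong[OF assms(1) _
        Suc.IH[of "\<lambda>x. frechet_derivative f (at x) v" "\<lambda>x. frechet_derivative g (at x) v"]])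
      (use Suc.prems add in auto)
  then show ?case using Suc.prems by simp
qed

lemma frechet_derivative_bounded_linear_compose:
  assumes "bounded_linear L" "f differentiable (at x)"
  shows "(\<lambda>y. L (f y)) differentiable (at x)"
    "frechet_derivative (\<lambda>y. L (f y)) (at x) v = L (frechet_derivative f (at x) v)"
proof -
  note D = bounded_linear.has_derivative[OF assms(1) frechet_derivative_works[THEN iffD1, OF assms(2)]]
  show "(\<lambda>y. L (f y)) differentiable (at x)" using D by (rule differentiableI)
  show "frechet_derivative (\<lambda>y. L (f y)) (at x) v = L (frechet_derivative f (at x) v)"
    by (simp flip: frechet_derivative_at[OF D])
qed

lemma Ck_on_bounded_linear_compose:
  assumes "open U" "bounded_linear L" "Ck_on k U f"
  shows "Ck_on k U (\<lambda>x. L (f x))"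
  using assms(3)
proof (induction k arbitrary: f)
  case 0
  then show ?case
    using assms(2) by (simp add: bounded_linear.continuous_on)
next
  case (Suc k)
  note 1 = frechet_derivative_bounded_linear_compose[OF assms(2)]
  have "Ck_on k U (\<lambda>x. frechet_derivative (\<lambda>x. L (f x)) (at x) v)" for v
    by (rule Ck_on_cong[OF assms(1) _ Suc.IH[of "\<lambda>x. frechet_derivative f (at x) v"]])
      (use Suc.prems in \<open>simp_all add: 1(2)\<close>)
  then show ?case using Suc.prems by (simp add: 1(1))
qed

lemma smooth_extension_component:
  fixes u g :: "'a::real_normed_vector \<Rightarrow> real^'n"
  assumes "smooth_extension S u g"
  shows "smooth_extension S (\<lambda>y. u y $ k) (\<lambda>y. g y $ k)"
  using assms Ck_on_bounded_linear_compose[OF _ bounded_linear_vec_nth, of _ _ g k]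
  unfolding smooth_extension_def smooth_on_def by auto

lemma smooth_extension_deformation:
  assumes "smooth_extension S u g"
  shows "smooth_extension S (deformation u) (\<lambda>y. y + g y)"
  using assms Ck_on_add[OF _ Ck_on_bounded_linear[OF bounded_linear_ident], of _ _ g]
  unfolding smooth_extension_def smooth_on_def deformation_def by auto

lemma smooth_extension_differentiable:
  assumes "smooth_extension S f g" "x \<in> S"
  shows "g differentiable (at x)"
proof -
  obtain U where "Ck_on (Suc 0) U g" "S \<subseteq> U"
    using assms(1) unfolding smooth_extension_def smooth_on_def by blast
  then show ?thesis using assms(2) by auto
qed

section \<open>Tangential derivatives on a curved element\<close>

text \<open>A one-sided chain rule: \<open>f \<circ> c\<close> vanishes along a segment that starts at \<open>r\<close>, and on an interval
  the derivative at an end point is unique. So \<open>r\<close> may be a boundary point of a cell or a vertex.\<close>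

lemma derivative_along_segment_eq_0:
  fixes c :: "'a::real_normed_vector \<Rightarrow> 'b::real_normed_vector"
    and f :: "'b \<Rightarrow> 'c::real_normed_vector"
  assumes c: "c differentiable (at r)" and f: "f differentiable (at (c r))"
    and 0: "\<And>y. y \<in> closed_segment r q \<Longrightarrow> f (c y) = 0"
  shows "frechet_derivative f (at (c r)) (frechet_derivative c (at r) (q - r)) = 0"
proof -
  let ?l = "\<lambda>s::real. r + s *\<^sub>R (q - r)"
  let ?Dc = "frechet_derivative c (at r)" let ?Df = "frechet_derivative f (at (c r))"
  have l: "(?l has_derivative (\<lambda>s. s *\<^sub>R (q - r))) (at 0)"
    by (auto intro!: derivative_eq_intros)
  have "(c has_derivative ?Dc) (at (?l 0))" using c by (simp flip: frechet_derivative_works)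
  from has_derivative_compose[OF l this]
  have cl: "((\<lambda>s. c (?l s)) has_derivative (\<lambda>s. ?Dc (s *\<^sub>R (q - r)))) (at 0)" .
  have "(f has_derivative ?Df) (at (c (?l 0)))" using f by (simp flip: frechet_derivative_works)
  from has_derivative_compose[OF cl this]
  have "((\<lambda>s. f (c (?l s))) has_derivative (\<lambda>s. ?Df (?Dc (s *\<^sub>R (q - r))))) (at 0)" .
  moreover have "?Df (?Dc (s *\<^sub>R v)) = s *\<^sub>R ?Df (?Dc v)" for s v
    using linear_scale[OF linear_frechet_derivative[OF c]] linear_scale[OF linear_frechet_derivative[OF f]]
    by simp
  ultimately have "((\<lambda>s. f (c (?l s))) has_vector_derivative ?Df (?Dc (q - r))) (at 0)"
    by (simp add: has_vector_derivative_def)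
  then have 1: "((\<lambda>s. f (c (?l s))) has_vector_derivative ?Df (?Dc (q - r))) (at 0 within cbox 0 1)"
    using has_vector_derivative_at_within by blast
  have seg: "?l s \<in> closed_segment r q" if "s \<in> cbox 0 1" for s
    using that unfolding in_segment
    by (auto intro!: exI[of _ s] simp: algebra_simps)
  have "((\<lambda>s. f (c (?l s))) has_vector_derivative 0) (at 0 within cbox 0 1)"
    by (rule has_vector_derivative_transform[of _ _ _ "\<lambda>s. 0"]) (use seg 0 in auto)
  with 1 show ?thesis
    using vector_derivative_unique_within_closed_interval[of 0 1 0] by simp
qed

lemma ref_cell_basics:
  "convex (ref_cell T)" "0 \<in> ref_cell T" "axis 1 1 \<in> ref_cell T" "axis 2 1 \<in> ref_cell T"
  unfolding ref_cell_def by (rule convex_convex_hull) (cases "shape T"; simp add: hull_inc)+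

lemma ref_point:
  assumes "x \<in> elem_set T"
  shows "ref_point T x \<in> ref_cell T" "chart T (ref_point T x) = x"
  using assms unfolding elem_set_def ref_point_def by (auto intro: inv_into_into f_inv_into_f)

lemma chart_differentiable:
  assumes "regular_element T" "x \<in> elem_set T"
  shows "chart T differentiable (at (ref_point T x))"
proof -
  obtain U where "ref_cell T \<subseteq> U" "Ck_on (Suc 0) U (chart T)"
    using assms(1) unfolding regular_element_def smooth_on_def by blast
  then show ?thesis using ref_point(1)[OF assms(2)] by auto
qed

lemma linear_chart_deriv:
  assumes "regular_element T" "x \<in> elem_set T"
  shows "linear (chart_deriv T x)" "inj (chart_deriv T x)"
  using linear_frechet_derivative[OF chart_differentiable[OF assms]] assms
  by (auto simp: chart_deriv_def regular_element_def)

lemma linear_2_expansion: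
  fixes L :: "real^2 \<Rightarrow> 'a::real_vector"
  assumes "linear L"
  shows "L v = v $ 1 *\<^sub>R L (axis 1 1) + v $ 2 *\<^sub>R L (axis 2 1)"
proof -
  have "L v = L (v $ 1 *\<^sub>R axis 1 1 + v $ 2 *\<^sub>R axis 2 1)"
    by (rule arg_cong[of _ _ L]) (simp add: vec_eq_iff forall_2 axis_def)
  then show ?thesis by (simp add: linear_add[OF assms] linear_scale[OF assms])
qed

text \<open>The difference of the two extensions vanishes on the element, so its derivative vanishes in all
  directions that point from the reference point into the cell. As a function of the target point of such a direction
  it is affine, and the three corners \<open>0\<close>, \<open>axis 1 1\<close>, \<open>axis 2 1\<close>, common to both shapes, force
  its linear part to vanish.\<close>

lemma tangential_derivative_unique:
  fixes f :: "real^3 \<Rightarrow> 'b::real_normed_vector"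
  assumes T: "regular_element T" "x \<in> elem_set T"
    and g: "smooth_extension (elem_set T) f g1" "smooth_extension (elem_set T) f g2"
    and d: "d \<in> range (chart_deriv T x)"
  shows "frechet_derivative g1 (at x) d = frechet_derivative g2 (at x) d"
proof -
  let ?r = "ref_point T x"
  let ?h = "\<lambda>y. g1 y - g2 y"
  have gd: "g1 differentiable (at x)" "g2 differentiable (at x)"
    using smooth_extension_differentiable g T(2) by blast+
  then have hd: "?h differentiable (at x)" by simp
  note lin = linear_frechet_derivative[OF hd] linear_chart_deriv(1)[OF T]
  let ?L = "\<lambda>v. frechet_derivative ?h (at x) (chart_deriv T x v)"
  have L: "linear ?L" using linear_compose[OF lin(2,1)] by (simp add: o_def)
  have h0: "?h y = 0" if "y \<in> elem_set T" for y using g that by (simp add: smooth_extension_def)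
  have "?L (q - ?r) = 0" if "q \<in> ref_cell T" for q
  proof -
    have "closed_segment ?r q \<subseteq> ref_cell T"
      using that ref_cell_basics(1) ref_point(1)[OF T(2)] by (simp add: closed_segment_subset)
    then have "?h (chart T y) = 0" if "y \<in> closed_segment ?r q" for y
      using that by (intro h0) (auto simp: elem_set_def)
    then show ?thesis
      using derivative_along_segment_eq_0[OF chart_differentiable[OF T], of ?h q] hd
      by (simp add: ref_point(2)[OF T(2)] chart_deriv_def)
  qed
  then have eq: "?L q = ?L ?r" if "q \<in> ref_cell T" for q
    using that linear_diff[OF L, of q ?r] by simp
  have "?L ?r = 0" using eq[OF ref_cell_basics(2)] linear_0[OF L] by simp
  then have a: "?L (axis 1 1) = 0" "?L (axis 2 1) = 0"
    using eq[OF ref_cell_basics(3)] eq[OF ref_cell_basics(4)] by simp_all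
  have "?L v = 0" for v
    using linear_2_expansion[OF L, of v] a by simp
  then show ?thesis
    using d frechet_derivative_diff_at[OF gd] by auto
qed

text \<open>The range is contained in the plane orthogonal to the normal, and both have dimension two.\<close>

lemma normal_chart_deriv:
  assumes "regular_element T" "x \<in> elem_set T"
  shows "norm (normal T x) = 1" "range (chart_deriv T x) = {d. normal T x \<bullet> d = 0}"
proof -
  let ?D = "chart_deriv T x" let ?a = "?D (axis 1 1)" let ?b = "?D (axis 2 1)"
  note lin = linear_chart_deriv[OF assms]
  note D = linear_2_expansion[OF lin(1)]
  have inj: "v = w" if "?D v = ?D w" for v w using that lin(2) by (rule injD[rotated])
  have "?a \<noteq> 0" using inj[of "axis 1 1" 0] linear_0[OF lin(1)] by (auto simp: axis_eq_0_iff)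
  moreover have "?b \<noteq> 0" using inj[of "axis 2 1" 0] linear_0[OF lin(1)] by (auto simp: axis_eq_0_iff)
  moreover have "?b \<noteq> c *\<^sub>R ?a" for c
    using inj[of "axis 2 1" "c *\<^sub>R axis 1 1"] linear_scale[OF lin(1)]
    by (auto simp: vec_eq_iff forall_2 axis_def)
  ultimately have "cross3 ?a ?b \<noteq> 0" by (simp add: cross_eq_0 collinear_lemma)
  then show n: "norm (normal T x) = 1" by (simp add: normal_def Let_def)
  have "range ?D \<subseteq> {d. normal T x \<bullet> d = 0}"
  proof
    fix d assume "d \<in> range ?D"
    then obtain v :: "real^2" where "d = v $ 1 *\<^sub>R ?a + v $ 2 *\<^sub>R ?b" using D by (elim rangeE) metis
    then show "d \<in> {d. normal T x \<bullet> d = 0}"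
      by (simp add: normal_def Let_def inner_add_right dot_cross_self)
  qed
  moreover have "dim (range ?D) = 2"
    using dim_image_eq[OF lin(1), of UNIV] lin(2) by (simp add: dim_UNIV inj_on_def)
  moreover have "dim {d. normal T x \<bullet> d = 0} = 2"
    using n dim_hyperplane[of "normal T x"] by fastforce
  ultimately show "range ?D = {d. normal T x \<bullet> d = 0}"
    by (intro subspace_dim_equal) (auto simp: subspace_hyperplane linear_subspace_image[OF lin(1)])
qed

lemma gradient_inner:
  assumes "g differentiable (at x)"
  shows "gradient g x \<bullet> d = frechet_derivative g (at x) d"
proof -
  note lin = linear_frechet_derivative[OF assms]
  have "frechet_derivative g (at x) d = frechet_derivative g (at x) (\<Sum>k\<in>UNIV. d $ k *\<^sub>R axis k 1)"
    using basis_expansion[of d] by (simp add: scalar_mult_eq_scaleR)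
  also have "\<dots> = gradient g x \<bullet> d"
    by (simp add: linear_sum[OF lin] linear_scale[OF lin] gradient_def inner_vec_def mult.commute)
  finally show ?thesis by simp
qed

lemma tangent_proj_inner:
  assumes "normal T x \<bullet> d = 0"
  shows "(tangent_proj T x *v w) \<bullet> d = w \<bullet> d"
proof -
  have "outer n n *v w = (n \<bullet> w) *\<^sub>R n" for n
    by (simp add: vec_eq_iff outer_def matrix_vector_mult_def inner_vec_def sum_distrib_left sum_distrib_right mult_ac)
  then show ?thesis
    using assms by (simp add: tangent_proj_def matrix_vector_mult_diff_rdistrib inner_diff_left)
qed

text \<open>The projection in the surface gradient is symmetric and fixes tangent vectors, so only the tangential
  derivative of the chosen extension remains, and that does not depend on the choice.\<close>

lemma surf_jac_mult_tangential:
  assumes T: "regular_element T" "x \<in> elem_set T"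
    and g: "smooth_extension (elem_set T) u g"
    and d: "normal T x \<bullet> d = 0"
  shows "surf_jac T u x *v d = frechet_derivative g (at x) d"
proof -
  have gd: "g differentiable (at x)" using smooth_extension_differentiable g T(2) by blast
  have "(surf_jac T u x *v d) $ k = frechet_derivative g (at x) d $ k" for k
  proof -
    let ?uk = "\<lambda>y. u y $ k" let ?gk = "\<lambda>y. g y $ k"
    define G where "G = (SOME G. smooth_extension (elem_set T) ?uk G)"
    have gk: "smooth_extension (elem_set T) ?uk ?gk" using g by (rule smooth_extension_component)
    then have G: "smooth_extension (elem_set T) ?uk G" unfolding G_def by (rule someI[of _ ?gk])
    have "(surf_jac T u x *v d) $ k = (tangent_proj T x *v gradient G x) \<bullet> d"
      by (simp add: matrix_vector_mul_component surf_jac_def surf_grad_def G_def)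
    also have "\<dots> = frechet_derivative G (at x) d"
      using tangent_proj_inner[OF d] gradient_inner smooth_extension_differentiable[OF G T(2)] by metis
    also have "\<dots> = frechet_derivative ?gk (at x) d"
      using tangential_derivative_unique[OF T G gk] d normal_chart_deriv(2)[OF T] by simp
    also have "\<dots> = frechet_derivative g (at x) d $ k"
      by (rule frechet_derivative_bounded_linear_compose[OF bounded_linear_vec_nth gd])
    finally show ?thesis .
  qed
  then show ?thesis by (simp add: vec_eq_iff)
qed

text \<open>If \<open>g\<close> extends the displacement, \<open>y + g y\<close> extends the deformation.\<close>

lemma def_grad_mult_tangential:
  assumes T: "regular_element T" "x \<in> elem_set T" and u: "smooth_on_elem T u"
    and d: "normal T x \<bullet> d = 0"
  shows "def_grad T u x *v d = d + surf_jac T u x *v d"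
proof -
  obtain g where g: "smooth_extension (elem_set T) u g" using u smooth_on_elem_def by blast
  have "g differentiable (at x)" using smooth_extension_differentiable g T(2) by blast
  then have "frechet_derivative (\<lambda>y. y + g y) (at x) d = d + frechet_derivative g (at x) d"
    by (simp add: frechet_derivative_plus_at)
  then show ?thesis
    using surf_jac_mult_tangential[OF T _ d] g smooth_extension_deformation[OF g]
    by (simp add: def_grad_def)
qed

section \<open>Edges\<close>

lemma ref_vertex_Suc_neq: "ref_vertex T (Suc i) \<noteq> ref_vertex T i"
proof -
  have ax: "axis 1 1 \<noteq> (0::real^2)" "axis 2 1 \<noteq> (0::real^2)" "axis 1 1 \<noteq> (axis 2 1 :: real^2)"
      "axis 1 1 + axis 2 1 \<noteq> (0::real^2)"
    by (auto simp: vec_eq_iff forall_2 axis_def)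
  have "distinct (ref_vertices (shape T))" using ax by (cases "shape T") (auto simp del: axis_eq_0_iff)
  moreover have "1 < nedges T" by (cases "shape T") (simp_all add: nedges_def)
  ultimately show ?thesis
    using mod_less_divisor[of "nedges T" i] mod_less_divisor[of "nedges T" "Suc i"] mod_Suc[of i "nedges T"]
    by (auto simp add: ref_vertex_def nth_eq_iff_index_eq split: if_splits simp flip: nedges_def)
qed

lemma tangent_eq:
  assumes "regular_element T" "x \<in> elem_set T"
  obtains c where "tangent T i x = c *\<^sub>R chart_deriv T x (ref_vertex T (Suc i) - ref_vertex T i)"
    "norm (tangent T i x) = 1" "normal T x \<bullet> tangent T i x = 0"
proof -
  let ?d = "chart_deriv T x (ref_vertex T (Suc i) - ref_vertex T i)"
  note lin = linear_chart_deriv[OF assms]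
  have "?d \<noteq> 0"
    using lin ref_vertex_Suc_neq[of T i] linear_injective_0 by (metis right_minus_eq)
  moreover have "tangent T i x = (1 / norm ?d) *\<^sub>R ?d \<or> tangent T i x = - (1 / norm ?d) *\<^sub>R ?d"
    by (simp add: tangent_def Let_def)
  then obtain c where c: "c = 1 / norm ?d \<or> c = - (1 / norm ?d)" "tangent T i x = c *\<^sub>R ?d"
    by metis
  moreover have "normal T x \<bullet> ?d = 0" using normal_chart_deriv(2)[OF assms] by blast
  ultimately show ?thesis using that[of c] by auto
qed

text \<open>Extensions from the two sides both agree with the single-valued \<open>u\<close> on the edge. Their difference
  vanishes along the edge curve of \<open>T\<close>, hence so does its derivative in the direction of the edge.\<close>

lemma tangential_derivative_continuous_across_edge:
  assumes T: "regular_element T" "regular_element T'" and x: "x \<in> edge T i" "edge T i \<subseteq> elem_set T'"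
    and u: "smooth_on_elem T u" "smooth_on_elem T' u"
    and n: "normal T' x \<bullet> tangent T i x = 0"
  shows "surf_jac T u x *v tangent T i x = surf_jac T' u x *v tangent T i x"
proof -
  let ?v = "ref_vertex T i" let ?w = "ref_vertex T (Suc i)"
  have len: "0 < length (ref_vertices (shape T))" by (cases "shape T") simp_all
  have "?v \<in> ref_cell T" "?w \<in> ref_cell T"
    using len by (simp_all add: ref_cell_def ref_vertex_def nedges_def hull_inc)
  then have seg: "closed_segment ?v ?w \<subseteq> ref_cell T"
    using ref_cell_basics(1) by (simp add: closed_segment_subset)
  then have eT: "edge T i \<subseteq> elem_set T" by (auto simp: edge_def elem_set_def)
  then have xT: "x \<in> elem_set T" "x \<in> elem_set T'" using x by auto
  let ?r = "ref_point T x"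
  have r: "?r \<in> closed_segment ?v ?w"
  proof -
    obtain y where y: "y \<in> closed_segment ?v ?w" "x = chart T y" using x(1) by (auto simp: edge_def)
    then have "?r = y"
      using T(1) seg by (auto simp: ref_point_def regular_element_def intro!: inv_into_f_f)
    then show ?thesis using y by simp
  qed
  obtain g g' where g: "smooth_extension (elem_set T) u g" "smooth_extension (elem_set T') u g'"
    using u by (auto simp: smooth_on_elem_def)
  have gd: "g differentiable (at x)" "g' differentiable (at x)"
    using smooth_extension_differentiable g xT by blast+
  let ?h = "\<lambda>y. g y - g' y"
  have hd: "?h differentiable (at x)" using gd by simp
  let ?L = "\<lambda>v. frechet_derivative ?h (at x) (chart_deriv T x v)"
  have L: "linear ?L"
    using linear_compose[OF linear_chart_deriv(1)[OF T(1) xT(1)] linear_frechet_derivative[OF hd]]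
    by (simp add: o_def)
  have "?L (q - ?r) = 0" if "q \<in> closed_segment ?v ?w" for q
  proof -
    have "?h (chart T y) = 0" if "y \<in> closed_segment ?r q" for y
    proof -
      have "closed_segment ?r q \<subseteq> closed_segment ?v ?w"
        using r \<open>q \<in> _\<close> by (simp add: subset_closed_segment)
      then have "chart T y \<in> edge T i" using that by (auto simp: edge_def)
      then have "chart T y \<in> elem_set T" "chart T y \<in> elem_set T'" using eT x(2) by blast+
      then show ?thesis using g by (simp add: smooth_extension_def)
    qed
    then show ?thesis
      using derivative_along_segment_eq_0[OF chart_differentiable[OF T(1) xT(1)], of ?h q] hd
      by (simp add: ref_point(2)[OF xT(1)] chart_deriv_def)
  qed
  then have "?L (?w - ?r) - ?L (?v - ?r) = 0" by simp
  then have "?L (?w - ?v) = 0" using linear_diff[OF L, symmetric] by simp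
  obtain c where c: "tangent T i x = c *\<^sub>R chart_deriv T x (?w - ?v)" "normal T x \<bullet> tangent T i x = 0"
    using tangent_eq[OF T(1) xT(1)] by blast
  have "frechet_derivative ?h (at x) (tangent T i x) = 0"
    using \<open>?L (?w - ?v) = 0\<close> linear_scale[OF linear_frechet_derivative[OF hd]] c(1) by simp
  then have "frechet_derivative g (at x) (tangent T i x) = frechet_derivative g' (at x) (tangent T i x)"
    using frechet_derivative_diff_at[OF gd] by simp
  then show ?thesis
    using surf_jac_mult_tangential[OF T(1) xT(1) g(1) c(2)] surf_jac_mult_tangential[OF T(2) xT(2) g(2) n]
    by simp
qed

section \<open>The change of the bending angle\<close>

text \<open>The normal is the cross product of \<open>t\<close> and the conormal, and cofactor matrices act on
  cross products factor by factor.\<close>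

lemma def_normal_eq:
  assumes T: "regular_element T" "x \<in> elem_set T" "smooth_on_elem T u"
    and t: "norm t = 1" "normal T x \<bullet> t = 0"
  defines "H \<equiv> surf_jac T u x" and "m \<equiv> cross3 (normal T x) t"
  shows "def_normal T u x = (1 / norm (cross3 (t + H *v t) (m + H *v m))) *\<^sub>R
    cross3 (t + H *v t) (m + H *v m)"
proof -
  have "normal T x = cross3 t m"
    using t normal_chart_deriv(1)[OF T(1,2)]
    by (simp add: m_def cross3_cross3_right dot_square_norm inner_commute)
  moreover have "normal T x \<bullet> m = 0" by (simp add: m_def dot_cross_self)
  ultimately have "cof (def_grad T u x) *v normal T x = cross3 (t + H *v t) (m + H *v m)"
    using def_grad_mult_tangential[OF T] t(2) by (metis cof_mult_cross H_def)
  then show ?thesis by (simp add: def_normal_def Let_def)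
qed

text \<open>The right element is described in terms of the left tangent \<open>\<tau>\<close>: its own tangent is \<open>-\<tau>\<close> and its deformed
  tangent is the opposite of the left one.\<close>

lemma bending_angle_change_at_point:
  assumes T: "regular_element TL" "regular_element TR"
    and x: "x \<in> edge TL i" "edge TL i \<subseteq> elem_set TL" "edge TL i \<subseteq> elem_set TR"
    and t: "tangent TL i x = - tangent TR j x"
    and u: "smooth_on_elem TL u" "smooth_on_elem TR u"
    and fold: "convex_fold (normal TL x) (conormal TL i x) (normal TR x) (conormal TR j x)"
      "convex_fold (def_normal TL u x) (def_conormal TL i u x) (def_normal TR u x) (def_conormal TR j u x)"
    and h: "norm (surf_jac TL u x) \<le> h" "norm (surf_jac TR u x) \<le> h" "h \<le> 1/100"
  shows "\<bar>vec_angle (def_normal TL u x) (def_normal TR u x) - vec_angle (normal TL x) (normal TR x)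
    - conormal_jump TL i TR j (rotation_field TL u) (rotation_field TR u) x\<bar> \<le> 2000 * h\<^sup>2"
proof -
  define \<tau> where "\<tau> = tangent TL i x"
  have \<tau>R: "tangent TR j x = - \<tau>" using t by (simp add: \<tau>_def)
  let ?nL = "normal TL x" let ?nR = "normal TR x"
  let ?mL = "cross3 ?nL \<tau>" let ?mR = "cross3 ?nR (- \<tau>)"
  let ?HL = "surf_jac TL u x" let ?HR = "surf_jac TR u x"
  let ?p = "\<tau> + ?HL *v \<tau>"
  have xT: "x \<in> elem_set TL" "x \<in> elem_set TR" using x by auto
  have n: "norm ?nL = 1" "norm ?nR = 1" using normal_chart_deriv(1) T xT by blast+
  have \<tau>: "norm \<tau> = 1" "?nL \<bullet> \<tau> = 0" unfolding \<tau>_def using tangent_eq[OF T(1) xT(1)] by blast+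
  have "?nR \<bullet> tangent TR j x = 0" using tangent_eq[OF T(2) xT(2)] by blast
  then have \<tau>nR: "?nR \<bullet> \<tau> = 0" by (simp add: \<tau>R)
  have HR: "?HR *v \<tau> = ?HL *v \<tau>"
    using tangential_derivative_continuous_across_edge[OF T x(1,3) u] \<tau>nR by (simp add: \<tau>_def)
  have \<nu>L: "def_normal TL u x = (1 / norm (cross3 ?p (?mL + ?HL *v ?mL))) *\<^sub>R cross3 ?p (?mL + ?HL *v ?mL)"
    using def_normal_eq[OF T(1) xT(1) u(1) \<tau>] .
  have neg: "- \<tau> + ?HR *v (- \<tau>) = - ?p"
    using linear_neg[OF matrix_vector_mul_linear, of ?HR \<tau>] by (simp add: HR)
  have \<nu>R: "def_normal TR u x = (1 / norm (cross3 (- ?p) (?mR + ?HR *v ?mR))) *\<^sub>R cross3 (- ?p) (?mR + ?HR *v ?mR)"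
    using def_normal_eq[OF T(2) xT(2) u(2), of "- \<tau>"] \<tau>(1) \<tau>nR unfolding neg by simp
  have fold1: "0 \<le> ?nR \<bullet> ?mL"
    using fold(1) by (simp add: convex_fold_def conormal_def \<tau>_def)
  have fold2: "0 \<le> def_normal TR u x \<bullet> cross3 (def_normal TL u x) ((1 / norm ?p) *\<^sub>R ?p)"
    using fold(2) def_grad_mult_tangential[OF T(1) xT(1) u(1) \<tau>(2)]
    by (simp add: convex_fold_def def_conormal_def Let_def \<tau>_def)
  have le: "norm (H *v v) \<le> h" if "norm H \<le> h" "norm v = 1" for H :: "real^3^3" and v
    using norm_matrix_vector_mult_le[of H v] that by simp
  have "norm ?mL = 1" "norm ?mR = 1"
    using norm_cross3_orthonormal n \<tau> \<tau>nR by simp_all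
  note b = bending_angle_expansion[OF n \<tau> \<tau>nR le[OF h(1) \<tau>(1)] le[OF h(1) this(1)]
      le[OF h(2) this(2)] h(3) fold1, folded \<nu>L \<nu>R, OF fold2]
  have transpose_inner: "(transpose H *v n) \<bullet> v = (H *v v) \<bullet> n" for H :: "real^3^3" and n v
    by (metis transpose_matrix_vector dot_lmul_matrix inner_commute)
  have "conormal_jump TL i TR j (rotation_field TL u) (rotation_field TR u) x
      = (?HL *v ?mL) \<bullet> ?nL + (?HR *v ?mR) \<bullet> ?nR"
    unfolding conormal_jump_def rotation_field_def conormal_def \<tau>R \<tau>_def[symmetric] transpose_inner ..
  then show ?thesis using b by simp
qed

text \<open>Eventuality in a product with a principal filter is uniformity over the set; positivity of \<open>\<epsilon>\<close>
  removes the absolute value.\<close>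

lemma uniform_bigo_iff:
  "uniform_bigo A k f \<longleftrightarrow> (\<exists>C. \<forall>\<^sub>F \<epsilon> in at_right 0. \<forall>x\<in>A. norm (f \<epsilon> x) \<le> C * \<epsilon> ^ k)"
proof
  assume "uniform_bigo A k f"
  then obtain C where "\<forall>\<^sub>F (\<epsilon>, x) in at_right 0 \<times>\<^sub>F principal A. norm (f \<epsilon> x) \<le> C * \<bar>\<epsilon> ^ k\<bar>"
    unfolding uniform_bigo_def by (elim landau_o.bigE) (simp add: case_prod_unfold)
  then have "\<forall>\<^sub>F \<epsilon> in at_right 0. \<forall>x\<in>A. norm (f \<epsilon> x) \<le> C * \<bar>\<epsilon> ^ k\<bar>"
    by (auto simp: eventually_prod_filter eventually_principal elim: eventually_mono)
  then have "\<forall>\<^sub>F \<epsilon> in at_right 0. \<forall>x\<in>A. norm (f \<epsilon> x) \<le> C * \<epsilon> ^ k"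
    using eventually_at_right_less[of 0] by eventually_elim simp
  then show "\<exists>C. \<forall>\<^sub>F \<epsilon> in at_right 0. \<forall>x\<in>A. norm (f \<epsilon> x) \<le> C * \<epsilon> ^ k" by blast
next
  assume "\<exists>C. \<forall>\<^sub>F \<epsilon> in at_right 0. \<forall>x\<in>A. norm (f \<epsilon> x) \<le> C * \<epsilon> ^ k"
  then obtain C where "\<forall>\<^sub>F \<epsilon> in at_right 0. \<forall>x\<in>A. norm (f \<epsilon> x) \<le> C * \<epsilon> ^ k" by blast
  then have "\<forall>\<^sub>F \<epsilon> in at_right 0. \<forall>x\<in>A. norm (f \<epsilon> x) \<le> C * \<bar>\<epsilon> ^ k\<bar>"
    using eventually_at_right_less[of 0] by eventually_elim simp
  then have "\<forall>\<^sub>F (\<epsilon>, x) in at_right 0 \<times>\<^sub>F principal A. norm (f \<epsilon> x) \<le> C * \<bar>\<epsilon> ^ k\<bar>"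
    unfolding eventually_prod_filter
    by (intro exI[of _ "\<lambda>\<epsilon>. \<forall>x\<in>A. norm (f \<epsilon> x) \<le> C * \<bar>\<epsilon> ^ k\<bar>"] exI[of _ "\<lambda>x. x \<in> A"])
      (simp add: eventually_principal)
  then show "uniform_bigo A k f"
    unfolding uniform_bigo_def by (intro bigoI[of _ C]) (simp add: case_prod_unfold)
qed

theorem lemma5p2:
  fixes M :: "element set"
    and u :: "real \<Rightarrow> real^3 \<Rightarrow> real^3"
    and \<gamma> :: "real \<Rightarrow> element \<Rightarrow> real^3 \<Rightarrow> real^3"
    and TL TR :: element and i j :: nat and A :: "(real^3) set"
  assumes "shell_mesh M"
    and "\<And>\<epsilon>. \<epsilon> > 0 \<Longrightarrow> displacement M (u \<epsilon>)"
    and "\<And>\<epsilon>. \<epsilon> > 0 \<Longrightarrow> shear M (\<gamma> \<epsilon>)"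
    and "\<And>T. T \<in> M \<Longrightarrow> uniform_bigo (elem_set T) 1 (\<lambda>\<epsilon>. surf_jac T (u \<epsilon>))"
    and "\<And>T. T \<in> M \<Longrightarrow> uniform_bigo (elem_set T) 1 (\<lambda>\<epsilon>. \<gamma> \<epsilon> T)"
    and "\<And>T. T \<in> M \<Longrightarrow> uniform_bigo (elem_set T) 1 (\<lambda>\<epsilon>. surf_jac T (\<gamma> \<epsilon> T))"
    and "TL \<in> M" and "TR \<in> M" and "share_edge TL i TR j"
    and "A \<subseteq> elem_set TL \<inter> elem_set TR"
    and "\<And>x. x \<in> A \<Longrightarrow>
           convex_fold (normal TL x) (conormal TL i x) (normal TR x) (conormal TR j x)"
    and "\<forall>\<^sub>F \<epsilon> in at_right 0. \<forall>x\<in>A.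
           convex_fold (def_normal TL (u \<epsilon>) x) (def_conormal TL i (u \<epsilon>) x)
                       (def_normal TR (u \<epsilon>) x) (def_conormal TR j (u \<epsilon>) x)"
  shows "uniform_bigo A 2 (\<lambda>\<epsilon> x.
           vec_angle (def_normal TL (u \<epsilon>) x) (def_normal TR (u \<epsilon>) x)
           - vec_angle (normal TL x) (normal TR x)
           - conormal_jump TL i TR j (rotation_field TL (u \<epsilon>)) (rotation_field TR (u \<epsilon>)) x)"
proof -
  have T: "regular_element TL" "regular_element TR"
    using assms(1,7,8) by (simp_all add: shell_mesh_def)
  have e: "edge TL i = elem_set TL \<inter> elem_set TR" using assms(9) by (simp add: share_edge_def)
  have t: "tangent TL i x = - tangent TR j x" if "x \<in> edge TL i" for x
    using assms(1,7,8,9) that unfolding shell_mesh_def consistently_oriented_def by blast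
  obtain CL where CL: "\<forall>\<^sub>F \<epsilon> in at_right 0. \<forall>x\<in>elem_set TL. norm (surf_jac TL (u \<epsilon>) x) \<le> CL * \<epsilon> ^ 1"
    using assms(4)[OF assms(7)] unfolding uniform_bigo_iff by blast
  obtain CR where CR: "\<forall>\<^sub>F \<epsilon> in at_right 0. \<forall>x\<in>elem_set TR. norm (surf_jac TR (u \<epsilon>) x) \<le> CR * \<epsilon> ^ 1"
    using assms(4)[OF assms(8)] unfolding uniform_bigo_iff by blast
  define C where "C = max CL CR"
  have small: "\<forall>\<^sub>F \<epsilon> in at_right 0. C * \<epsilon> < 1/100"
  proof (rule order_tendstoD)
    show "((\<lambda>\<epsilon>. C * \<epsilon>) \<longlongrightarrow> 0) (at_right 0)" by (auto intro!: tendsto_eq_intros)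
  qed simp
  from CL CR small assms(12) eventually_at_right_less[of "0::real"]
  have "\<forall>\<^sub>F \<epsilon> in at_right 0. \<forall>x\<in>A.
      norm (vec_angle (def_normal TL (u \<epsilon>) x) (def_normal TR (u \<epsilon>) x)
           - vec_angle (normal TL x) (normal TR x)
           - conormal_jump TL i TR j (rotation_field TL (u \<epsilon>)) (rotation_field TR (u \<epsilon>)) x)
      \<le> (2000 * C\<^sup>2) * \<epsilon>\<^sup>2"
  proof eventually_elim
    case (elim \<epsilon>)
    have u: "smooth_on_elem TL (u \<epsilon>)" "smooth_on_elem TR (u \<epsilon>)"
      using assms(2)[OF elim(5)] assms(7,8) by (simp_all add: displacement_def)
    show ?case
    proof
      fix x assume "x \<in> A"
      then have x: "x \<in> elem_set TL" "x \<in> elem_set TR" using assms(10) by auto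
      have "CL * \<epsilon> \<le> C * \<epsilon>" "CR * \<epsilon> \<le> C * \<epsilon>"
        using elim(5) by (simp_all add: C_def mult_right_mono)
      then have h: "norm (surf_jac TL (u \<epsilon>) x) \<le> C * \<epsilon>" "norm (surf_jac TR (u \<epsilon>) x) \<le> C * \<epsilon>"
        using elim(1,2) x by force+
      show "norm (vec_angle (def_normal TL (u \<epsilon>) x) (def_normal TR (u \<epsilon>) x)
           - vec_angle (normal TL x) (normal TR x)
           - conormal_jump TL i TR j (rotation_field TL (u \<epsilon>)) (rotation_field TR (u \<epsilon>)) x)
        \<le> (2000 * C\<^sup>2) * \<epsilon>\<^sup>2"
        using bending_angle_change_at_point[OF T _ _ _ t u assms(11)[OF \<open>x \<in> A\<close>] _ h]
          e x elim(3,4) \<open>x \<in> A\<close> by (simp add: power_mult_distrib mult.assoc)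
    qed
  qed
  then show ?thesis unfolding uniform_bigo_iff by blast
qed

end
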